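(* Every ordered matching on $2n$ vertices contains a line, a stack, or a wave of size at least $n^{1/3}$.
   Context: Here $n$ is a positive integer. An ordered matching of size $n$ is a graph on a linearly ordered vertex set $V$ with $|V|=2n$ (say $V=\{1,\dots,2n\}$) consisting of $n$ pairwise vertex-disjoint edges (so there are no isolated vertices). The size of a matching is its number of edges. A sub-matching is a subset of the edges, its vertices inheriting the linear order. A matching with $k$ edges $\{a_i,b_i\}$, $a_i<b_i$, $i=1,\dots,k$, numbered so that $a_1<\cdots<a_k$, is called: a line if $a_1<b_1<a_2<b_2<\cdots<a_k<b_k$; a stack if $a_1<a_2<\cdots<a_k<b_k<b_{k-1}<\cdots<b_1$; a wave if $a_1<a_2<\cdots<a_k<b_1<b_2<\cdots<b_k$. A matching contains a line (stack, wave) if some sub-matching of it is a line (stack, wave). *)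

theory Defs
  imports Complex_Main
begin

text \<open>The vertices are elements of a linearly ordered type. An edge is a two-element set of
  vertices and a matching is given by its set of edges. As \<^term>\<open>n\<close> disjoint edges cover all
  \<^term>\<open>2 * n\<close> vertices, there are no isolated vertices.\<close>

definition ordered_matching :: "nat \<Rightarrow> 'a::linorder set \<Rightarrow> 'a set set \<Rightarrow> bool" where
  "ordered_matching n V E \<longleftrightarrow>
     finite V \<and> card V = 2 * n \<and>
     (\<forall>e\<in>E. e \<subseteq> V \<and> card e = 2) \<and> pairwise disjnt E \<and> card E = n"

text \<open>In the next three definitions \<^term>\<open>ps\<close> lists the pairs
  \<open>(a\<^sub>1, b\<^sub>1), \<dots>, (a\<^sub>k, b\<^sub>k)\<close> of edge endpoints. Each chain of inequalities is
  strict sortedness of the endpoints written out in the corresponding order; it forces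
  \<open>a\<^sub>i < b\<^sub>i\<close>, \<open>a\<^sub>1 < \<dots> < a\<^sub>k\<close>, and that the number of edges is \<open>k\<close>.\<close>

definition edges_of :: "('a \<times> 'a) list \<Rightarrow> 'a set set" where
  "edges_of ps = (\<lambda>(a, b). {a, b}) ` set ps"

text \<open>\<open>a\<^sub>1 < b\<^sub>1 < a\<^sub>2 < b\<^sub>2 < \<dots> < a\<^sub>k < b\<^sub>k\<close>\<close>
definition is_line :: "'a::linorder set set \<Rightarrow> bool" where
  "is_line M \<longleftrightarrow>
     (\<exists>ps. M = edges_of ps \<and> sorted_wrt (<) (concat (map (\<lambda>(a, b). [a, b]) ps)))"

text \<open>\<open>a\<^sub>1 < \<dots> < a\<^sub>k < b\<^sub>k < \<dots> < b\<^sub>1\<close>\<close>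
definition is_stack :: "'a::linorder set set \<Rightarrow> bool" where
  "is_stack M \<longleftrightarrow>
     (\<exists>ps. M = edges_of ps \<and> sorted_wrt (<) (map fst ps @ rev (map snd ps)))"

text \<open>\<open>a\<^sub>1 < \<dots> < a\<^sub>k < b\<^sub>1 < \<dots> < b\<^sub>k\<close>\<close>
definition is_wave :: "'a::linorder set set \<Rightarrow> bool" where
  "is_wave M \<longleftrightarrow>
     (\<exists>ps. M = edges_of ps \<and> sorted_wrt (<) (map fst ps @ map snd ps))"

end

theory Submission
  imports Defs
begin

text \<open>Write an edge as a pair \<open>(a, b)\<close> with \<open>a < b\<close>. Precedence \<open>b < a'\<close> is a partial order whose
  chains are lines; let \<open>h\<close> be the height function of this order. Two edges of the same height are
  not separated, so the edges of one height have all their left ends before all their right ends;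
  on such a set, chains of nested edges are stacks and chains of edges increasing in both ends are
  waves. Any two edges are comparable in one of these three orders (the third one being restricted
  to pairs of equal height), so the triple of the three heights determines the edge, and one of the
  orders has height at least the cube root of \<open>n\<close>.\<close>

lemma sorted_wrt_irreflp_distinct:
  assumes "irreflp_on P R" "set xs \<subseteq> P" "sorted_wrt R xs"
  shows "distinct xs"
  using assms by (induction xs) (auto simp: irreflp_on_def)

lemma sorted_wrt_comparable:
  assumes "sorted_wrt R xs" "x \<in> set xs" "y \<in> set xs"
  shows "x = y \<or> R x y \<or> R y x"
  using assms by (induction xs) auto

text \<open>The height of \<open>x\<close> is the greatest length of a chain strictly below
  \<open>x\<close>; putting \<open>x\<close> on top of such a chain shows that heights grow along
  \<open>R\<close>. The list \<open>xs\<close> is a longest chain, so heights take at most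
  \<open>length xs\<close> values.\<close>

lemma ex_height_function:
  assumes fin: "finite P" and irr: "irreflp_on P R" and tr: "transp_on P R"
  obtains h :: "'b \<Rightarrow> nat" and xs where
    "set xs \<subseteq> P" "sorted_wrt R xs" "\<And>x. x \<in> P \<Longrightarrow> h x < length xs"
    "\<And>x y. x \<in> P \<Longrightarrow> y \<in> P \<Longrightarrow> R x y \<Longrightarrow> h x < h y"
proof (cases "P = {}")
  case True
  then show thesis using that[of "[]" "\<lambda>_. 0"] by auto
next
  case False
  \<comment> \<open>The list omits \<open>x\<close> itself, so minimal elements get height 0. The
    empty list always qualifies, which makes the maximum in \<open>h\<close> meaningful.\<close>
  define chains where "chains x = {xs. set xs \<subseteq> P \<and> sorted_wrt R (xs @ [x])}" for x
  define h where "h x = Max (length ` chains x)" for x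
  have fin_chains: "finite (chains x)" for x
  proof (rule finite_subset)
    show "chains x \<subseteq> {xs. set xs \<subseteq> P \<and> length xs \<le> card P}"
    proof
      fix xs assume "xs \<in> chains x"
      then have xs: "set xs \<subseteq> P" "sorted_wrt R xs"
        by (auto simp: chains_def sorted_wrt_append)
      then have "length xs = card (set xs)"
        using sorted_wrt_irreflp_distinct[OF irr] by (simp add: distinct_card)
      with xs show "xs \<in> {xs. set xs \<subseteq> P \<and> length xs \<le> card P}"
        using card_mono[OF fin] by auto
    qed
  qed (rule finite_lists_length_le[OF fin])
  have "h x \<in> length ` chains x" for x
    unfolding h_def using fin_chains by (intro Max_in) (auto simp: chains_def intro: exI[of _ "[]"])
  then have h_attained: "\<exists>xs \<in> chains x. length xs = h x" for x
    by (metis imageE)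
  have h_ge: "length xs \<le> h x" if "xs \<in> chains x" for xs x
    unfolding h_def using that fin_chains by (intro Max_ge) auto
  have mono: "h x < h y" if xy: "x \<in> P" "y \<in> P" "R x y" for x y
  proof -
    obtain xs where xs: "xs \<in> chains x" "length xs = h x" using h_attained by blast
    have "R z y" if "z \<in> set xs" for z
      using xs(1) xy that transp_onD[OF tr, of z x y] by (auto simp: chains_def sorted_wrt_append)
    with xs xy have "xs @ [x] \<in> chains y"
      by (auto simp: chains_def sorted_wrt_append)
    from h_ge[OF this] xs show ?thesis by simp
  qed
  \<comment> \<open>Below an element \<open>z\<close> of greatest height lies a chain of length
    \<open>h z\<close>; appending \<open>z\<close> makes its length exceed every height.\<close>
  have "Max (h ` P) \<in> h ` P" using fin False by (intro Max_in) auto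
  then obtain z where z: "z \<in> P" "h z = Max (h ` P)" by auto
  obtain xs where xs: "xs \<in> chains z" "length xs = h z" using h_attained by blast
  show thesis
  proof (rule that[of "xs @ [z]" h])
    show "set (xs @ [z]) \<subseteq> P" "sorted_wrt R (xs @ [z])" using xs z by (auto simp: chains_def)
    show "h x < length (xs @ [z])" if "x \<in> P" for x
      using that fin xs(2) z(2) by (simp add: less_Suc_eq_le)
  qed (use mono in auto)
qed

lemma powr_third_le_if_le_cube:
  fixes n k :: nat
  assumes "n \<le> k ^ 3"
  shows "real n powr (1 / 3) \<le> real k"
proof (cases "k = 0")
  case False
  have "real n powr (1 / 3) \<le> (real k ^ 3) powr (1 / 3)"
    using assms by (intro powr_mono2) (auto simp flip: of_nat_power)
  also have "\<dots> = real k"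
    using False powr_powr[of "real k" 3 "1 / 3"] by simp
  finally show ?thesis .
qed (use assms in simp)

lemma le_mult3_imp_le_cube:
  fixes n a b c :: nat
  assumes "n \<le> a * (b * c)"
  obtains "n \<le> a ^ 3" | "n \<le> b ^ 3" | "n \<le> c ^ 3"
proof -
  define m where "m = max a (max b c)"
  have "a * (b * c) \<le> m * (m * m)"
    unfolding m_def by (intro mult_le_mono) auto
  with assms have "n \<le> m ^ 3" by (simp add: power3_eq_cube mult.assoc)
  then show thesis using that unfolding m_def max_def by (auto split: if_splits)
qed

lemma is_line_edges_of:
  assumes "\<forall>p \<in> set ps. fst p < snd p" "sorted_wrt (\<lambda>p q. snd p < fst q) ps"
  shows "is_line (edges_of ps)"
proof -
  have "sorted_wrt (<) (concat (map (\<lambda>(a, b). [a, b]) ps))"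
    using assms by (induction ps) (auto, force+)
  then show ?thesis unfolding is_line_def by blast
qed

text \<open>Nesting alone separates the ends: if \<open>q\<close> lies inside \<open>p\<close>, then
  \<open>fst p < fst q < snd q < snd p\<close>, so each left end precedes each right end.\<close>

lemma is_stack_edges_of:
  assumes "\<forall>p \<in> set ps. fst p < snd p"
    and "sorted_wrt (\<lambda>p q. fst p < fst q \<and> snd q < snd p) ps"
  shows "is_stack (edges_of ps)"
proof -
  have "fst p < snd q" if "p \<in> set ps" "q \<in> set ps" for p q
    using sorted_wrt_comparable[OF assms(2) that] assms(1) that by (metis less_trans)
  moreover have "sorted_wrt (\<lambda>p q. fst p < fst q) ps" "sorted_wrt (\<lambda>p q. snd q < snd p) ps"
    using assms(2) by (auto elim: sorted_wrt_mono_rel[rotated])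
  ultimately show ?thesis unfolding is_stack_def
    by (intro exI[of _ ps]) (auto simp: sorted_wrt_append sorted_wrt_map sorted_wrt_rev)
qed

text \<open>Unlike nested edges, edges increasing in both ends may be separated, so the first
  assumption ranges over all pairs of edges.\<close>

lemma is_wave_edges_of:
  assumes "\<forall>p \<in> set ps. \<forall>q \<in> set ps. fst p < snd q"
    and "sorted_wrt (\<lambda>p q. fst p < fst q \<and> snd p < snd q) ps"
  shows "is_wave (edges_of ps)"
proof -
  have "sorted_wrt (\<lambda>p q. fst p < fst q) ps" "sorted_wrt (\<lambda>p q. snd p < snd q) ps"
    using assms(2) by (auto elim: sorted_wrt_mono_rel[rotated])
  with assms(1) show ?thesis unfolding is_wave_def
    by (intro exI[of _ ps]) (auto simp: sorted_wrt_append sorted_wrt_map)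
qed

lemma inj_on_doubleton:
  "inj_on (\<lambda>(a, b). {a, b}) {(a, b). (a :: 'a :: linorder) < b}"
  by (auto simp: inj_on_def doubleton_eq_iff)

theorem corollary3:
  fixes V :: "'a::linorder set" and E :: "'a set set" and n :: nat
  assumes "n \<ge> 1" and "ordered_matching n V E"
  shows "\<exists>M \<subseteq> E. (is_line M \<or> is_stack M \<or> is_wave M) \<and> real (card M) \<ge> real n powr (1 / 3)"
proof -
  have E: "\<And>e. e \<in> E \<Longrightarrow> card e = 2" "pairwise disjnt E" "card E = n"
    using assms(2) by (auto simp: ordered_matching_def)
  have "finite E" using E(3) assms(1) card.infinite[of E] by fastforce
  define P where "P = {(a, b). a < b \<and> {a, b} \<in> E}"
  have inj: "inj_on (\<lambda>(a, b). {a, b}) P"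
    by (rule inj_on_subset[OF inj_on_doubleton]) (auto simp: P_def)
  have "e \<in> (\<lambda>(a, b). {a, b}) ` P" if e: "e \<in> E" for e
  proof -
    obtain a b where ab: "e = {a, b}" "a < b"
      using E(1)[OF e] by (metis card_2_iff insert_commute neqE)
    with e have "(a, b) \<in> P" by (simp add: P_def)
    then show ?thesis using ab by force
  qed
  then have img: "(\<lambda>(a, b). {a, b}) ` P = E"
    by (auto simp: P_def)
  have finP: "finite P" using inj img \<open>finite E\<close> finite_imageD by metis
  have cardP: "card P = n" using card_image[OF inj] img E(3) by simp
  have less: "fst p < snd p" if "p \<in> P" for p using that by (auto simp: P_def)
  \<comment> \<open>Distinct edges share no vertex, so comparisons between their ends are always
    strict.\<close>
  have disj: "fst p \<noteq> fst q \<and> snd p \<noteq> snd q \<and> snd p \<noteq> fst q" if pq: "p \<in> P" "q \<in> P" "p \<noteq> q" for p q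
  proof -
    have "{fst p, snd p} \<noteq> {fst q, snd q}" "{fst p, snd p} \<in> E" "{fst q, snd q} \<in> E"
      using inj_onD[OF inj, of p q] pq by (auto simp: P_def split_beta)
    then have "disjnt {fst p, snd p} {fst q, snd q}" using E(2) by (blast dest: pairwiseD)
    then show ?thesis by (auto simp: disjnt_def)
  qed
  define L where "L p q \<longleftrightarrow> snd p < fst q" for p q :: "'a \<times> 'a"
  define S where "S p q \<longleftrightarrow> fst p < fst q \<and> snd q < snd p" for p q :: "'a \<times> 'a"
  have "irreflp_on P L" "transp_on P L"
    by (auto simp: irreflp_on_def transp_on_def L_def dest!: less)
  then obtain h ls where ls: "set ls \<subseteq> P" "sorted_wrt L ls" "\<And>x. x \<in> P \<Longrightarrow> h x < length ls"
    and h: "\<And>x y. x \<in> P \<Longrightarrow> y \<in> P \<Longrightarrow> L x y \<Longrightarrow> h x < (h y :: nat)"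
    using ex_height_function[OF finP] by metis
  have "irreflp_on P S" "transp_on P S"
    by (auto simp: irreflp_on_def transp_on_def S_def)
  then obtain s ss where ss: "set ss \<subseteq> P" "sorted_wrt S ss" "\<And>x. x \<in> P \<Longrightarrow> s x < length ss"
    and s: "\<And>x y. x \<in> P \<Longrightarrow> y \<in> P \<Longrightarrow> S x y \<Longrightarrow> s x < (s y :: nat)"
    using ex_height_function[OF finP] by metis
  \<comment> \<open>The clause \<open>h p = h q\<close> excludes separated edges, whose
    \<open>L\<close>-heights differ, and keeps \<open>W\<close> transitive.\<close>
  define W where "W p q \<longleftrightarrow> fst p < fst q \<and> snd p < snd q \<and> h p = h q" for p q :: "'a \<times> 'a"
  have "irreflp_on P W" "transp_on P W"
    by (auto simp: irreflp_on_def transp_on_def W_def)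
  then obtain w ws where ws: "set ws \<subseteq> P" "sorted_wrt W ws" "\<And>x. x \<in> P \<Longrightarrow> w x < length ws"
    and w: "\<And>x y. x \<in> P \<Longrightarrow> y \<in> P \<Longrightarrow> W x y \<Longrightarrow> w x < (w y :: nat)"
    using ex_height_function[OF finP] by metis
  \<comment> \<open>Two distinct edges of equal \<open>h\<close> are nested or increase in both
    ends, hence are comparable under \<open>S\<close> or \<open>W\<close>; then \<open>s\<close> or
    \<open>w\<close> tells them apart.\<close>
  have "inj_on (\<lambda>p. (h p, s p, w p)) P"
  proof (rule inj_onI, rule ccontr)
    fix p q assume pq: "p \<in> P" "q \<in> P" "(h p, s p, w p) = (h q, s q, w q)" "p \<noteq> q"
    then have "S p q \<or> S q p \<or> W p q \<or> W q p"
      using disj[of p q] unfolding S_def W_def by auto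
    with pq s[of p q] s[of q p] w[of p q] w[of q p] show False by auto
  qed
  then have "card P \<le> card ({..<length ls} \<times> {..<length ss} \<times> {..<length ws})"
    using ls(3) ss(3) ws(3) by (intro card_inj_on_le) auto
  then have "n \<le> length ls * (length ss * length ws)" by (simp add: cardP)
  then have cubes: "n \<le> length ls ^ 3 \<or> n \<le> length ss ^ 3 \<or> n \<le> length ws ^ 3"
    using le_mult3_imp_le_cube by metis
  have "is_line (edges_of ls)"
    using ls less by (intro is_line_edges_of) (auto simp: L_def[abs_def])
  moreover have "is_stack (edges_of ss)"
    using ss less by (intro is_stack_edges_of) (auto simp: S_def[abs_def])
  moreover have "is_wave (edges_of ws)"
  proof (rule is_wave_edges_of)
    show "\<forall>p \<in> set ws. \<forall>q \<in> set ws. fst p < snd q"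
    proof (intro ballI)
      fix p q assume pq: "p \<in> set ws" "q \<in> set ws"
      then have P: "p \<in> P" "q \<in> P" using ws(1) by auto
      \<comment> \<open>All edges of a \<open>W\<close>-chain have the same \<open>L\<close>-height,
        so \<open>L\<close> relates no two of them.\<close>
      have "h p = h q" using sorted_wrt_comparable[OF ws(2) pq] by (auto simp: W_def)
      then have "\<not> L q p" using h[OF P(2,1)] by auto
      then show "fst p < snd q"
        using less[OF P(1)] disj[OF P(2,1)] unfolding L_def by (cases "p = q") auto
    qed
    show "sorted_wrt (\<lambda>p q. fst p < fst q \<and> snd p < snd q) ws"
      using ws(2) by (rule sorted_wrt_mono_rel[rotated]) (auto simp: W_def)
  qed
  \<comment> \<open>Chains of an irreflexive relation have no repetitions and distinct pairs in
    \<open>P\<close> give distinct edges, so list length counts edges.\<close>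
  moreover have edges: "edges_of ps \<subseteq> E \<and> card (edges_of ps) = length ps"
    if "set ps \<subseteq> P" "sorted_wrt R ps" "irreflp_on P R" for ps R
  proof
    show "edges_of ps \<subseteq> E" using that(1) img unfolding edges_of_def by blast
    have "card (edges_of ps) = card (set ps)"
      unfolding edges_of_def using inj that(1) by (intro card_image) (rule inj_on_subset)
    also have "\<dots> = length ps"
      using sorted_wrt_irreflp_distinct[OF that(3,1,2)] by (rule distinct_card)
    finally show "card (edges_of ps) = length ps" .
  qed
  ultimately show ?thesis
    using cubes powr_third_le_if_le_cube
      edges[OF ls(1,2) \<open>irreflp_on P L\<close>] edges[OF ss(1,2) \<open>irreflp_on P S\<close>]
      edges[OF ws(1,2) \<open>irreflp_on P W\<close>] by metis
qed

end
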